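(* Let $P$ be a finite graded bounded poset with minimum $\widehat0$, maximum $\widehat1$ and rank function $\rho$. Then the $\chi$-Chow polynomial of $P$ is $$\mathrm{H}_P(x)=\sum_{\widehat0=p_0<p_1<\dots<p_m\le\widehat1}\ \prod_{i=1}^m\frac{x\big(x^{\rho(p_i)-\rho(p_{i-1})-1}-1\big)}{x-1},$$ where the sum is over all chains of the indicated form (any $m\ge0$).
   Context: For a finite graded bounded poset $P$, $\rho(w)$ is the length of any saturated chain from $\widehat0$ to $w$, and $\rho_{st}=\rho(t)-\rho(s)$. The incidence algebra $\mathcal{I}(P)$ consists of maps $a$ assigning to each closed interval $[s,t]$ a polynomial $a_{st}(x)\in\mathbb{Z}[x]$, with product $(ab)_{st}=\sum_{s\le w\le t}a_{sw}b_{wt}$. The characteristic function is $\chi_{st}(x)=\sum_{s\le w\le t}\mu_{sw}x^{\rho_{wt}}$, where $\mu$ is the Möbius function; it is a kernel (i.e. $\chi_{ss}=1$ and $\chi^{-1}=\chi^{\mathrm{rev}}$, where $a^{\mathrm{rev}}_{st}(x)=x^{\rho_{st}}a_{st}(x^{-1})$). For $s<t$, $\chi_{st}$ is divisible by $x-1$; let $\overline{\chi}_{st}=\chi_{st}/(x-1)$ for $s<t$ and $\overline{\chi}_{ss}=-1$. The $\chi$-Chow function is $\mathrm{H}=-(\overline{\chi})^{-1}$, and the $\chi$-Chow polynomial of $P$ is $\mathrm{H}_P=\mathrm{H}_{\widehat0\widehat1}$. *)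

theory Defs
  imports "HOL-Algebra.Order" "HOL-Algebra.Ring" "HOL-Computational_Algebra.Polynomial"
begin

abbreviation polyX :: "int poly" where "polyX \<equiv> [:0, 1:]"

definition covers :: "('a, 'b) gorder_scheme \<Rightarrow> 'a \<Rightarrow> 'a \<Rightarrow> bool" where
  "covers P s t \<longleftrightarrow> s \<in> carrier P \<and> t \<in> carrier P \<and> s \<sqsubset>\<^bsub>P\<^esub> t \<and>
     \<not> (\<exists>w \<in> carrier P. s \<sqsubset>\<^bsub>P\<^esub> w \<and> w \<sqsubset>\<^bsub>P\<^esub> t)"

text \<open>A saturated chain is represented by the list of its elements in increasing order;
  its length in the order-theoretic sense is one less than the length of the list.\<close>

definition saturated_chain :: "('a, 'b) gorder_scheme \<Rightarrow> 'a \<Rightarrow> 'a \<Rightarrow> 'a list \<Rightarrow> bool" where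
  "saturated_chain P s t ps \<longleftrightarrow> ps \<noteq> [] \<and> set ps \<subseteq> carrier P \<and> hd ps = s \<and> last ps = t \<and>
     successively (covers P) ps"

text \<open>Gradedness: all saturated chains from the minimum to a given element have the same length.
  As every such chain extends to a maximal chain of \<open>P\<close>, this is the same as requiring that all
  maximal chains have the same length.\<close>

locale finite_graded_bounded_poset =
  partial_order P + weak_partial_order_bottom P + weak_partial_order_top P
  for P (structure) +
  assumes finite_carrier: "finite (carrier P)"
    and graded: "\<And>w ps qs. \<lbrakk>w \<in> carrier P; saturated_chain P \<bottom> w ps; saturated_chain P \<bottom> w qs\<rbrakk>
      \<Longrightarrow> length ps = length qs"

definition rank :: "('a, 'b) gorder_scheme \<Rightarrow> 'a \<Rightarrow> nat" where
  "rank P w = (THE n. \<exists>ps. saturated_chain P \<bottom>\<^bsub>P\<^esub> w ps \<and> length ps = Suc n)"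

text \<open>Only meaningful for \<open>s \<le> t\<close>, where the subtraction does not truncate.\<close>

definition rank_diff :: "('a, 'b) gorder_scheme \<Rightarrow> 'a \<Rightarrow> 'a \<Rightarrow> nat" where
  "rank_diff P s t = rank P t - rank P s"

definition is_interval :: "('a, 'b) gorder_scheme \<Rightarrow> 'a \<Rightarrow> 'a \<Rightarrow> bool" where
  "is_interval P s t \<longleftrightarrow> s \<in> carrier P \<and> t \<in> carrier P \<and> s \<sqsubseteq>\<^bsub>P\<^esub> t"

text \<open>A map on the closed intervals \<open>[s,t]\<close> is encoded as a function of the two endpoints that
  vanishes at pairs not spanning an interval, so that functions agreeing on all intervals are
  equal. For such functions the convolution below again vanishes at those pairs.\<close>

definition incidence_algebra ::
    "('a, 'b) gorder_scheme \<Rightarrow> ('a \<Rightarrow> 'a \<Rightarrow> int poly) ring" where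
  "incidence_algebra P =
    \<lparr> carrier = {a. \<forall>s t. \<not> is_interval P s t \<longrightarrow> a s t = 0},
      monoid.mult = (\<lambda>a b s t. \<Sum>w \<in> \<lbrace>s..t\<rbrace>\<^bsub>P\<^esub>. a s w * b w t),
      one = (\<lambda>s t. if is_interval P s t \<and> s = t then 1 else 0),
      zero = (\<lambda>s t. 0),
      add = (\<lambda>a b s t. a s t + b s t) \<rparr>"

definition zeta_fun :: "('a, 'b) gorder_scheme \<Rightarrow> 'a \<Rightarrow> 'a \<Rightarrow> int poly" where
  "zeta_fun P = (\<lambda>s t. if is_interval P s t then 1 else 0)"

definition moebius_fun :: "('a, 'b) gorder_scheme \<Rightarrow> 'a \<Rightarrow> 'a \<Rightarrow> int poly" where
  "moebius_fun P = inv\<^bsub>incidence_algebra P\<^esub> (zeta_fun P)"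

definition char_fun :: "('a, 'b) gorder_scheme \<Rightarrow> 'a \<Rightarrow> 'a \<Rightarrow> int poly" where
  "char_fun P = (\<lambda>s t. if is_interval P s t
     then \<Sum>w \<in> \<lbrace>s..t\<rbrace>\<^bsub>P\<^esub>. moebius_fun P s w * polyX ^ rank_diff P w t
     else 0)"

text \<open>For \<open>s < t\<close> the polynomial \<open>char_fun P s t\<close> is a multiple of \<open>polyX - 1\<close>
  (its value at 1 is the sum of the Moebius function over \<open>[s,t]\<close>), so the division is exact.\<close>

definition reduced_char_fun :: "('a, 'b) gorder_scheme \<Rightarrow> 'a \<Rightarrow> 'a \<Rightarrow> int poly" where
  "reduced_char_fun P = (\<lambda>s t. if is_interval P s t
     then (if s = t then - 1 else char_fun P s t div (polyX - 1))
     else 0)"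

definition chow_fun :: "('a, 'b) gorder_scheme \<Rightarrow> 'a \<Rightarrow> 'a \<Rightarrow> int poly" where
  "chow_fun P =
     \<ominus>\<^bsub>incidence_algebra P\<^esub> (inv\<^bsub>incidence_algebra P\<^esub> (reduced_char_fun P))"

definition chow_polynomial :: "('a, 'b) gorder_scheme \<Rightarrow> int poly" where
  "chow_polynomial P = chow_fun P \<bottom>\<^bsub>P\<^esub> \<top>\<^bsub>P\<^esub>"

text \<open>The chains \<open>p\<^sub>0 < \<dots> < p\<^sub>m \<le> \<top>\<close> with \<open>p\<^sub>0 = \<bottom>\<close>, as lists of length \<open>m + 1\<close>.\<close>

definition chains_from_bottom :: "('a, 'b) gorder_scheme \<Rightarrow> 'a list set" where
  "chains_from_bottom P = {ps. ps \<noteq> [] \<and> set ps \<subseteq> carrier P \<and> hd ps = \<bottom>\<^bsub>P\<^esub> \<and>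
     sorted_wrt (\<lambda>s t. s \<sqsubset>\<^bsub>P\<^esub> t) ps \<and> last ps \<sqsubseteq>\<^bsub>P\<^esub> \<top>\<^bsub>P\<^esub>}"

end

theory Submission
  imports Defs
begin

text \<open>Since \<open>\<chi> = \<mu> \<zeta>\<^sup>r\<^sup>e\<^sup>v\<close>, multiplication by \<open>(x - 1) \<zeta>\<close> turns the reduced characteristic function into
  \<open>\<zeta>\<^sup>r\<^sup>e\<^sup>v - x \<zeta>\<close>; hence \<open>\<zeta> \<chi>' = E - 1\<close>, where \<open>\<chi>'\<close> is the reduced characteristic
  function and \<open>E\<close> has the factors of the claimed products as its entries. Multiplying by the Chow
  function \<open>H\<close>, the negative of the inverse of \<open>\<chi>'\<close>, gives \<open>(1 - E) H = \<zeta>\<close>, that is,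
  \<open>H s \<top> = 1 + (\<Sum>w > s. E s w * H w \<top>)\<close>. Splitting off the first step of a chain shows that the sum
  over the chains starting at \<open>s\<close> obeys the same recursion.\<close>

section \<open>Factors of the products, and chains with an arbitrary starting point\<close>

lemma polyX_minus_1_dvd_power: "polyX - 1 dvd polyX ^ n - 1"
  by (simp add: power_diff_1_eq)

text \<open>For \<open>s < t\<close> at rank distance \<open>r\<close> this is
  \<open>x + ... + x^(r-1)\<close>, the entry of \<open>E\<close> at \<open>(s, t)\<close>; it is 0
  for covers. It is not cut off outside intervals, so it is not itself an element of the incidence
  algebra.\<close>

definition chow_step :: "('a, 'b) gorder_scheme \<Rightarrow> 'a \<Rightarrow> 'a \<Rightarrow> int poly" where
  "chow_step P s t = (polyX * (polyX ^ (rank P t - rank P s - 1) - 1)) div (polyX - 1)"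

lemma chow_step_mult: "(polyX - 1) * chow_step P s t = polyX * (polyX ^ (rank P t - rank P s - 1) - 1)"
  unfolding chow_step_def by (rule dvd_mult_div_cancel) (rule dvd_mult, rule polyX_minus_1_dvd_power)

definition chains_from :: "('a, 'b) gorder_scheme \<Rightarrow> 'a \<Rightarrow> 'a list set" where
  "chains_from P s = {ps. ps \<noteq> [] \<and> set ps \<subseteq> carrier P \<and> hd ps = s \<and>
     sorted_wrt (\<lambda>s t. s \<sqsubset>\<^bsub>P\<^esub> t) ps}"

text \<open>The factor at index 1 is split off and the remaining indices are shifted down by one.
  This is the effect on the weight of a chain when an element is put in front.\<close>

lemma prod_steps_Cons:
  fixes f :: "'a \<Rightarrow> 'a \<Rightarrow> 'c::comm_monoid_mult"
  assumes "ps \<noteq> []"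
  shows "(\<Prod>i = 1..length (s # ps) - 1. f ((s # ps) ! (i - 1)) ((s # ps) ! i)) =
    f s (hd ps) * (\<Prod>i = 1..length ps - 1. f (ps ! (i - 1)) (ps ! i))"
proof -
  obtain n where n: "length ps = Suc n" using assms by (cases ps) auto
  have "(\<Prod>i = 1..Suc n. f ((s # ps) ! (i - 1)) ((s # ps) ! i)) =
      f s (ps ! 0) * (\<Prod>i = 2..Suc n. f ((s # ps) ! (i - 1)) ((s # ps) ! i))"
    by (subst prod.atLeast_Suc_atMost) (auto simp: numeral_2_eq_2)
  also have "(\<Prod>i = 2..Suc n. f ((s # ps) ! (i - 1)) ((s # ps) ! i)) =
      (\<Prod>i = 1..n. f (ps ! (i - 1)) (ps ! i))"
    by (rule prod.reindex_bij_witness[where i = Suc and j = "\<lambda>i. i - 1"]) (auto simp: nth_Cons')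
  finally show ?thesis using n assms by (simp add: hd_conv_nth)
qed

context finite_graded_bounded_poset
begin

section \<open>Intervals, downward induction, saturated chains and rank\<close>

lemma finite_at_least_at_most [simp]: "finite \<lbrace>s..t\<rbrace>"
  by (rule finite_subset[OF at_least_at_most_closed finite_carrier])

lemma is_intervalD: "is_interval P s t \<Longrightarrow> s \<in> carrier P \<and> t \<in> carrier P \<and> s \<sqsubseteq> t"
  by (simp add: is_interval_def)

lemma at_least_at_most_self [simp]: "s \<in> carrier P \<Longrightarrow> \<lbrace>s..s\<rbrace> = {s}"
  by (auto simp: at_least_at_most_def intro: le_antisym)

lemma card_above_less:
  assumes "s \<in> carrier P" "w \<in> carrier P" "s \<sqsubset> w"
  shows "card {v \<in> carrier P. w \<sqsubset> v} < card {v \<in> carrier P. s \<sqsubset> v}"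
proof (rule psubset_card_mono)
  show "{v \<in> carrier P. w \<sqsubset> v} \<subset> {v \<in> carrier P. s \<sqsubset> v}"
    using assms lless_trans[of s w] by (auto simp: lless_eq)
qed (use finite_carrier in auto)

text \<open>Downward induction along the order: the number of elements strictly above
  \<open>s\<close> drops when \<open>s\<close> moves up.\<close>

lemma above_induct [consumes 1, case_names above]:
  assumes "s \<in> carrier P"
    and "\<And>s. \<lbrakk>s \<in> carrier P; \<And>w. \<lbrakk>w \<in> carrier P; s \<sqsubset> w\<rbrakk> \<Longrightarrow> Q w\<rbrakk> \<Longrightarrow> Q s"
  shows "Q s"
  using assms(1)
proof (induction "card {v \<in> carrier P. s \<sqsubset> v}" arbitrary: s rule: less_induct)
  case less
  show ?case
    by (rule assms(2)[OF less.prems]) (use less card_above_less in simp)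
qed

text \<open>Among the elements of the half-open interval from \<open>s\<close> (excluded) to
  \<open>t\<close>, take \<open>w\<close> with the most elements strictly above it. An element
  strictly between \<open>s\<close> and \<open>w\<close> would have still more.\<close>

lemma ex_cover:
  assumes "s \<in> carrier P" "t \<in> carrier P" "s \<sqsubset> t"
  shows "\<exists>w. covers P s w \<and> w \<sqsubseteq> t"
proof -
  define Q where "Q w \<longleftrightarrow> w \<in> carrier P \<and> s \<sqsubset> w \<and> w \<sqsubseteq> t" for w
  define c where "c w = card {u \<in> carrier P. w \<sqsubset> u}" for w
  \<comment> \<open>\<open>ex_has_greatest_nat\<close> asks for a strict upper bound on
    \<open>c\<close>.\<close>
  have "c w < Suc (card (carrier P))" for w
    unfolding c_def less_Suc_eq_le by (rule card_mono[OF finite_carrier]) blast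
  moreover have "Q t" using assms by (simp add: Q_def)
  ultimately obtain w where w: "Q w" and max: "\<And>v. Q v \<Longrightarrow> c v \<le> c w"
    using ex_has_greatest_nat[of Q t c "Suc (card (carrier P))"] by blast
  have "\<not> (s \<sqsubset> v \<and> v \<sqsubset> w)" if v: "v \<in> carrier P" for v
  proof
    assume *: "s \<sqsubset> v \<and> v \<sqsubset> w"
    then have "v \<sqsubseteq> t"
      using v w assms le_trans[of v w t] by (simp add: Q_def lless_eq)
    then have "c v \<le> c w" using v * by (intro max) (simp add: Q_def)
    moreover have "c w < c v"
      unfolding c_def using v w * by (intro card_above_less) (simp_all add: Q_def)
    ultimately show False by simp
  qed
  then show ?thesis using w assms(1) unfolding covers_def Q_def by blast
qed

text \<open>Going down from \<open>t\<close>, \<open>s\<close> is put in front of a chain that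
  starts at a cover of \<open>s\<close> below \<open>t\<close>.\<close>

lemma saturated_chain_exists:
  assumes "s \<in> carrier P" "t \<in> carrier P" "s \<sqsubseteq> t"
  shows "\<exists>ps. saturated_chain P s t ps"
  using assms
proof (induction rule: above_induct)
  case (above s)
  show ?case
  proof (cases "s = t")
    case True
    then have "saturated_chain P s t [s]" using above.hyps by (simp add: saturated_chain_def)
    then show ?thesis ..
  next
    case False
    then obtain w where w: "covers P s w" "w \<sqsubseteq> t"
      using above.hyps above.prems ex_cover[of s t] by (auto simp: lless_eq)
    then obtain ps where "saturated_chain P w t ps"
      using above by (auto simp: covers_def)
    then have "saturated_chain P s t (s # ps)"
      using w by (auto simp: saturated_chain_def successively_Cons covers_def)
    then show ?thesis ..
  qed
qed

text \<open>Gradedness makes the number described by \<open>THE\<close> unique. The successor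
  appears because the list counts elements, not steps.\<close>

lemma rank_eq:
  assumes "w \<in> carrier P" "saturated_chain P \<bottom> w ps"
  shows "length ps = Suc (rank P w)"
proof -
  have ne: "length ps = Suc (length ps - 1)"
    using assms by (cases ps) (auto simp: saturated_chain_def)
  have "rank P w = length ps - 1"
    unfolding rank_def
  proof (rule the_equality)
    show "\<exists>qs. saturated_chain P \<bottom> w qs \<and> length qs = Suc (length ps - 1)"
      using assms ne by auto
    show "n = length ps - 1" if "\<exists>qs. saturated_chain P \<bottom> w qs \<and> length qs = Suc n" for n
      using that graded[OF assms(1) _ assms(2)] by auto
  qed
  with ne show ?thesis by simp
qed

text \<open>A chain from \<open>\<bottom>\<close> to \<open>s\<close> is prolonged by one from
  \<open>s\<close> to \<open>t\<close>, which has at least one step because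
  \<open>s \<noteq> t\<close>.\<close>

lemma rank_less:
  assumes "s \<in> carrier P" "t \<in> carrier P" "s \<sqsubset> t"
  shows "rank P s < rank P t"
proof -
  obtain ps where ps: "saturated_chain P \<bottom> s ps"
    using saturated_chain_exists[of "\<bottom>" s] assms by auto
  obtain qs where qs: "saturated_chain P s t qs"
    using saturated_chain_exists[of s t] assms by (auto simp: lless_eq)
  obtain q qs' where q: "qs = s # q # qs'"
    using qs assms(3) by (cases qs; cases "tl qs") (auto simp: saturated_chain_def lless_eq)
  \<comment> \<open>\<open>s\<close> already ends \<open>ps\<close>, so only the tail of
    \<open>qs\<close> is appended.\<close>
  have "saturated_chain P \<bottom> t (ps @ q # qs')"
    using ps qs by (auto simp: saturated_chain_def q successively_append_iff)
  from rank_eq[OF assms(2) this] rank_eq[OF assms(1) ps] show ?thesis by simp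
qed

lemma rank_diff_self [simp]: "rank_diff P s s = 0"
  by (simp add: rank_diff_def)

section \<open>Sums over chains\<close>

lemma chains_from_rec:
  assumes "s \<in> carrier P"
  shows "chains_from P s =
    insert [s] (\<Union>w \<in> {w \<in> carrier P. s \<sqsubset> w}. (#) s ` chains_from P w)" (is "_ = ?R")
proof (intro equalityI subsetI)
  fix ps assume ps: "ps \<in> chains_from P s"
  then obtain qs where qs: "ps = s # qs" by (cases ps) (auto simp: chains_from_def)
  show "ps \<in> ?R"
  proof (cases qs)
    case (Cons w ws)
    then have "qs \<in> chains_from P w" "w \<in> carrier P" "s \<sqsubset> w"
      using ps qs by (auto simp: chains_from_def)
    then show ?thesis using qs by blast
  qed (use qs in simp)
next
  fix ps assume "ps \<in> ?R"
  then consider "ps = [s]"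
    | w qs where "w \<in> carrier P" "s \<sqsubset> w" "qs \<in> chains_from P w" "ps = s # qs" by blast
  then show "ps \<in> chains_from P s"
  proof cases
    case 2
    then obtain ws where "qs = w # ws" by (cases qs) (auto simp: chains_from_def)
    then show ?thesis
      using 2 assms lless_trans[OF 2(2)] by (auto simp: chains_from_def)
  qed (use assms in \<open>simp add: chains_from_def\<close>)
qed

lemma finite_chains_from: "s \<in> carrier P \<Longrightarrow> finite (chains_from P s)"
proof (induction rule: above_induct)
  case (above s)
  then show ?case using finite_carrier by (simp add: chains_from_rec[OF above.hyps])
qed

text \<open>The summand 1 is the empty product of the chain \<open>[s]\<close>. The other chains are
  grouped by their second element \<open>w\<close>; the groups are disjoint, and
  \<open>(#) s\<close> maps the chains from \<open>w\<close> injectively onto theirs.\<close>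

lemma chain_sum_rec:
  fixes f :: "'a \<Rightarrow> 'a \<Rightarrow> 'c::comm_semiring_1"
  defines "F s \<equiv> \<Sum>ps \<in> chains_from P s. \<Prod>i = 1..length ps - 1. f (ps ! (i - 1)) (ps ! i)"
  assumes s: "s \<in> carrier P"
  shows "F s = 1 + (\<Sum>w \<in> {w \<in> carrier P. s \<sqsubset> w}. f s w * F w)"
proof -
  let ?p = "\<lambda>ps. \<Prod>i = 1..length ps - 1. f (ps ! (i - 1)) (ps ! i)"
  let ?A = "{w \<in> carrier P. s \<sqsubset> w}"
  let ?U = "\<lambda>w. (#) s ` chains_from P w"
  have fin: "finite ?A" using finite_carrier by simp
  have "sum ?p (\<Union>w \<in> ?A. ?U w) = (\<Sum>w \<in> ?A. sum ?p (?U w))"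
  proof (rule sum.UNION_disjoint[OF fin])
    show "\<forall>w \<in> ?A. finite (?U w)" using finite_chains_from by simp
    have "?U v \<inter> ?U w = {}" if "v \<noteq> w" for v w
      using that by (auto simp: chains_from_def)
    then show "\<forall>v \<in> ?A. \<forall>w \<in> ?A. v \<noteq> w \<longrightarrow> ?U v \<inter> ?U w = {}" by blast
  qed
  also have "\<dots> = (\<Sum>w \<in> ?A. f s w * F w)"
  proof (rule sum.cong[OF HOL.refl])
    fix w
    have "sum ?p (?U w) = (\<Sum>ps \<in> chains_from P w. ?p (s # ps))"
      by (subst sum.reindex) (auto simp: o_def)
    also have "\<dots> = (\<Sum>ps \<in> chains_from P w. f s w * ?p ps)"
    proof (rule sum.cong[OF HOL.refl])
      fix ps assume "ps \<in> chains_from P w"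
      then have "ps \<noteq> []" "hd ps = w" by (auto simp: chains_from_def)
      then show "?p (s # ps) = f s w * ?p ps" using prod_steps_Cons[of ps f s] by simp
    qed
    finally show "sum ?p (?U w) = f s w * F w" by (simp add: F_def sum_distrib_left)
  qed
  finally have *: "sum ?p (\<Union>w \<in> ?A. ?U w) = (\<Sum>w \<in> ?A. f s w * F w)" .
  have "F s = ?p [s] + sum ?p (\<Union>w \<in> ?A. ?U w)"
    unfolding F_def chains_from_rec[OF s]
  proof (rule sum.insert)
    show "finite (\<Union>w \<in> ?A. ?U w)" using fin finite_chains_from by simp
    show "[s] \<notin> (\<Union>w \<in> ?A. ?U w)" by (auto simp: chains_from_def)
  qed
  then show ?thesis unfolding * by simp
qed

section \<open>The incidence algebra as a ring, and its units\<close>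

abbreviation IA where "IA \<equiv> incidence_algebra P"

lemma IA_carrier: "a \<in> carrier IA \<longleftrightarrow> (\<forall>s t. \<not> is_interval P s t \<longrightarrow> a s t = 0)"
  by (simp add: incidence_algebra_def)

lemma IA_mult: "(a \<otimes>\<^bsub>IA\<^esub> b) s t = (\<Sum>w \<in> \<lbrace>s..t\<rbrace>. a s w * b w t)"
  by (simp add: incidence_algebra_def)

lemma IA_add: "(a \<oplus>\<^bsub>IA\<^esub> b) s t = a s t + b s t"
  by (simp add: incidence_algebra_def)

lemma IA_zero: "\<zero>\<^bsub>IA\<^esub> s t = 0"
  by (simp add: incidence_algebra_def)

lemma IA_one: "\<one>\<^bsub>IA\<^esub> s t = (if is_interval P s t \<and> s = t then 1 else 0)"
  by (simp add: incidence_algebra_def)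

text \<open>A summand can be nonzero only if \<open>s \<sqsubseteq> w\<close> and
  \<open>w \<sqsubseteq> t\<close>, and then transitivity makes \<open>s\<close>, \<open>t\<close>
  span an interval.\<close>

lemma IA_mult_closed:
  assumes "a \<in> carrier IA" "b \<in> carrier IA"
  shows "a \<otimes>\<^bsub>IA\<^esub> b \<in> carrier IA"
proof -
  have "a s w * b w t = 0" if "\<not> is_interval P s t" for s w t
  proof (cases "is_interval P s w \<and> is_interval P w t")
    case True
    with that show ?thesis using le_trans[of s w t] by (auto simp: is_interval_def)
  qed (use assms in \<open>auto simp: IA_carrier\<close>)
  then show ?thesis unfolding IA_carrier IA_mult by (intro allI impI sum.neutral ballI)
qed

lemma IA_mult_assoc:
  "(a \<otimes>\<^bsub>IA\<^esub> b) \<otimes>\<^bsub>IA\<^esub> c = a \<otimes>\<^bsub>IA\<^esub> (b \<otimes>\<^bsub>IA\<^esub> c)" (is "?l = ?r")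
  if "a \<in> carrier IA" "b \<in> carrier IA" "c \<in> carrier IA"
proof (intro ext)
  fix s t
  show "?l s t = ?r s t"
  proof (cases "is_interval P s t")
    case True
    then have st: "s \<in> carrier P" "t \<in> carrier P" by (auto simp: is_interval_def)
    have "?l s t = (\<Sum>w \<in> \<lbrace>s..t\<rbrace>. \<Sum>v \<in> \<lbrace>s..w\<rbrace>. a s v * b v w * c w t)"
      by (simp add: IA_mult sum_distrib_right)
    \<comment> \<open>Both double sums run over
      \<open>s \<sqsubseteq> v \<sqsubseteq> w \<sqsubseteq> t\<close>; swapping the components of
      the index pairs matches them.\<close>
    also have "\<dots> = (\<Sum>v \<in> \<lbrace>s..t\<rbrace>. \<Sum>w \<in> \<lbrace>v..t\<rbrace>. a s v * b v w * c w t)"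
      unfolding sum.Sigma[OF finite_at_least_at_most ballI[OF finite_at_least_at_most]]
      by (rule sum.reindex_bij_witness[where i = prod.swap and j = prod.swap];
          clarsimp simp: at_least_at_most_def; meson le_trans st)
    also have "\<dots> = ?r s t"
      by (simp add: IA_mult sum_distrib_left mult.assoc)
    finally show ?thesis .
  next
    case False
    moreover have "?l \<in> carrier IA" "?r \<in> carrier IA"
      by (intro IA_mult_closed that)+
    ultimately show ?thesis by (simp add: IA_carrier)
  qed
qed

lemma ring_incidence_algebra: "ring IA"
proof (rule ringI)
  show "abelian_group IA"
  proof (rule abelian_groupI)
    fix a assume "a \<in> carrier IA"
    then show "\<exists>b \<in> carrier IA. b \<oplus>\<^bsub>IA\<^esub> a = \<zero>\<^bsub>IA\<^esub>"
      by (intro bexI[of _ "\<lambda>s t. - a s t"] ext) (auto simp: IA_carrier IA_add IA_zero)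
  qed (auto simp: IA_carrier IA_add IA_zero fun_eq_iff)
  show "monoid IA"
  proof (rule monoidI)
    show "\<one>\<^bsub>IA\<^esub> \<in> carrier IA" by (auto simp: IA_carrier IA_one)
  next
    fix a assume a: "a \<in> carrier IA"
    show "\<one>\<^bsub>IA\<^esub> \<otimes>\<^bsub>IA\<^esub> a = a"
    proof (intro ext)
      fix s t
      have "(\<one>\<^bsub>IA\<^esub> \<otimes>\<^bsub>IA\<^esub> a) s t = (\<Sum>w \<in> \<lbrace>s..t\<rbrace>. if w = s then a s t else 0)"
        unfolding IA_mult
        by (rule sum.cong)
          (use a in \<open>auto simp: IA_one IA_carrier is_interval_def at_least_at_most_def\<close>)
      also have "\<dots> = a s t"
        using a by (auto simp: IA_carrier is_interval_def at_least_at_most_def finite_carrier)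
      finally show "(\<one>\<^bsub>IA\<^esub> \<otimes>\<^bsub>IA\<^esub> a) s t = a s t" .
    qed
    show "a \<otimes>\<^bsub>IA\<^esub> \<one>\<^bsub>IA\<^esub> = a"
    proof (intro ext)
      fix s t
      have "(a \<otimes>\<^bsub>IA\<^esub> \<one>\<^bsub>IA\<^esub>) s t = (\<Sum>w \<in> \<lbrace>s..t\<rbrace>. if w = t then a s t else 0)"
        unfolding IA_mult
        by (rule sum.cong)
          (use a in \<open>auto simp: IA_one IA_carrier is_interval_def at_least_at_most_def\<close>)
      also have "\<dots> = a s t"
        using a by (auto simp: IA_carrier is_interval_def at_least_at_most_def finite_carrier)
      finally show "(a \<otimes>\<^bsub>IA\<^esub> \<one>\<^bsub>IA\<^esub>) s t = a s t" .
    qed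
  qed (auto intro: IA_mult_closed IA_mult_assoc)
qed (auto simp: IA_mult IA_add fun_eq_iff algebra_simps sum.distrib)

sublocale IA: ring "incidence_algebra P"
  by (rule ring_incidence_algebra)

lemma IA_minus:
  assumes "a \<in> carrier IA"
  shows "(\<ominus>\<^bsub>IA\<^esub> a) s t = - a s t"
proof -
  have "a s t + (\<ominus>\<^bsub>IA\<^esub> a) s t = 0"
    using IA.r_neg[OF assms] by (metis IA_add IA_zero)
  then show ?thesis by (simp add: minus_unique)
qed

text \<open>The equation \<open>a b = 1\<close> at \<open>(s, t)\<close> determines
  \<open>b s t\<close> from the values \<open>b w t\<close> with \<open>w\<close> above
  \<open>s\<close>, once \<open>a s s\<close> is invertible; by \<open>diag\<close> it is its own
  inverse. The claim on the diagonal of \<open>b\<close> lets the lemma be applied to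
  \<open>b\<close> in turn.\<close>

lemma IA_right_inverse:
  assumes a: "a \<in> carrier IA" and diag: "\<And>s. s \<in> carrier P \<Longrightarrow> a s s * a s s = 1"
  shows "\<exists>b \<in> carrier IA. a \<otimes>\<^bsub>IA\<^esub> b = \<one>\<^bsub>IA\<^esub> \<and> (\<forall>s \<in> carrier P. b s s = a s s)"
proof -
  \<comment> \<open>Pairs are compared by the number of elements above the first component, since
    the recursion keeps \<open>t\<close> and moves \<open>s\<close> up.\<close>
  define R :: "(('a \<times> 'a) \<times> ('a \<times> 'a)) set"
    where "R = inv_image (measure (\<lambda>s. card {v \<in> carrier P. s \<sqsubset> v})) fst"
  \<comment> \<open>The convolution equation solved for its term at \<open>w = s\<close>, with
    \<open>a s s\<close> as the inverse of \<open>a s s\<close>.\<close>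
  define F where "F = (\<lambda>(b :: 'a \<times> 'a \<Rightarrow> int poly) (s, t). if is_interval P s t
    then a s s * ((if s = t then 1 else 0) - (\<Sum>w \<in> \<lbrace>s..t\<rbrace> - {s}. a s w * b (w, t))) else 0)"
  have "adm_wf R F"
    unfolding adm_wf_def
  proof (intro allI impI)
    fix f g :: "'a \<times> 'a \<Rightarrow> int poly" and x :: "'a \<times> 'a"
    assume eq: "\<forall>z. (z, x) \<in> R \<longrightarrow> f z = g z"
    obtain s t where x: "x = (s, t)" by (cases x)
    have "f (w, t) = g (w, t)" if "w \<in> \<lbrace>s..t\<rbrace> - {s}" "is_interval P s t" for w
      using eq card_above_less[of s w] that
      by (auto simp: R_def x lless_eq is_interval_def at_least_at_most_def)
    then show "F f x = F g x" by (simp add: F_def x)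
  qed
  moreover have "wf R" by (simp add: R_def)
  ultimately have fixpt: "wfrec R F = F (wfrec R F)" by (rule wfrec_fixpoint[rotated])
  define b where "b s t = wfrec R F (s, t)" for s t
  have b: "b s t = (if is_interval P s t
    then a s s * ((if s = t then 1 else 0) - (\<Sum>w \<in> \<lbrace>s..t\<rbrace> - {s}. a s w * b w t)) else 0)" for s t
    unfolding b_def by (subst fixpt) (simp add: F_def)
  have bI: "b \<in> carrier IA" by (simp add: IA_carrier b)
  have "(a \<otimes>\<^bsub>IA\<^esub> b) s t = \<one>\<^bsub>IA\<^esub> s t" for s t
  proof (cases "is_interval P s t")
    case True
    then have s: "s \<in> \<lbrace>s..t\<rbrace>" "s \<in> carrier P" by (auto simp: is_interval_def at_least_at_most_def)
    let ?S = "\<Sum>w \<in> \<lbrace>s..t\<rbrace> - {s}. a s w * b w t"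
    have "(a \<otimes>\<^bsub>IA\<^esub> b) s t = a s s * b s t + ?S"
      unfolding IA_mult using s by (simp add: sum.remove)
    also have "a s s * b s t = (a s s * a s s) * ((if s = t then 1 else 0) - ?S)"
      using True by (subst b) (simp only: if_True mult.assoc)
    finally show ?thesis using True diag[OF s(2)] by (simp add: IA_one)
  next
    case False
    then show ?thesis using IA.m_closed[OF a bI] by (simp add: IA_carrier IA_one)
  qed
  moreover have "b s s = a s s" if "s \<in> carrier P" for s
    using that by (subst b) (simp add: is_interval_def)
  ultimately show ?thesis using bI by blast
qed

text \<open>A right inverse \<open>b\<close> of \<open>a\<close> has a right inverse
  \<open>c\<close> itself. Then \<open>a\<close> and \<open>c\<close> are a left and a right inverse
  of \<open>b\<close>, hence equal, and \<open>b\<close> is two-sided.\<close>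

lemma IA_Units:
  assumes a: "a \<in> carrier IA" and diag: "\<And>s. s \<in> carrier P \<Longrightarrow> a s s * a s s = 1"
  shows "a \<in> Units IA"
proof -
  obtain b where b: "b \<in> carrier IA" "a \<otimes>\<^bsub>IA\<^esub> b = \<one>\<^bsub>IA\<^esub>" "\<forall>s \<in> carrier P. b s s = a s s"
    using IA_right_inverse[OF assms] by blast
  then obtain c where c: "c \<in> carrier IA" "b \<otimes>\<^bsub>IA\<^esub> c = \<one>\<^bsub>IA\<^esub>"
    using IA_right_inverse[of b] diag by auto
  have "a = c" using IA.inv_unique[OF b(2) c(2) b(1) a c(1)] .
  with a b c show ?thesis by (auto simp: Units_def)
qed

section \<open>Zeta, Moebius and characteristic functions\<close>

lemma zeta_fun_Units: "zeta_fun P \<in> Units IA"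
  by (rule IA_Units) (auto simp: IA_carrier zeta_fun_def is_interval_def)

lemma zeta_fun_mult:
  assumes "is_interval P s t"
  shows "(zeta_fun P \<otimes>\<^bsub>IA\<^esub> a) s t = (\<Sum>w \<in> \<lbrace>s..t\<rbrace>. a w t)"
  unfolding IA_mult
  by (rule sum.cong) (use assms in \<open>auto simp: zeta_fun_def is_interval_def at_least_at_most_def\<close>)

lemma moebius_fun_closed: "moebius_fun P \<in> carrier IA"
  using zeta_fun_Units by (simp add: moebius_fun_def)

text \<open>The reverse of the zeta function: reversing the constant 1 on an interval gives
  \<open>x\<close> to the rank difference.\<close>

definition rank_power :: "'a \<Rightarrow> 'a \<Rightarrow> int poly" where
  "rank_power s t = (if is_interval P s t then polyX ^ rank_diff P s t else 0)"

lemma rank_power_closed: "rank_power \<in> carrier IA"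
  by (simp add: IA_carrier rank_power_def)

lemma char_fun_eq: "char_fun P = moebius_fun P \<otimes>\<^bsub>IA\<^esub> rank_power"
proof (intro ext)
  fix s t
  show "char_fun P s t = (moebius_fun P \<otimes>\<^bsub>IA\<^esub> rank_power) s t"
  proof (cases "is_interval P s t")
    case True
    then show ?thesis
      by (auto simp: char_fun_def IA_mult rank_power_def is_interval_def at_least_at_most_def
          intro!: sum.cong)
  next
    case False
    then show ?thesis
      using IA.m_closed[OF moebius_fun_closed rank_power_closed]
      by (simp add: IA_carrier char_fun_def)
  qed
qed

text \<open>Multiplying by zeta on the left cancels the Moebius factor in
  \<open>char_fun_eq\<close>.\<close>

lemma zeta_char_fun: "zeta_fun P \<otimes>\<^bsub>IA\<^esub> char_fun P = rank_power"
proof -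
  have "zeta_fun P \<otimes>\<^bsub>IA\<^esub> char_fun P =
      (zeta_fun P \<otimes>\<^bsub>IA\<^esub> moebius_fun P) \<otimes>\<^bsub>IA\<^esub> rank_power"
    using zeta_fun_Units moebius_fun_closed rank_power_closed
    by (simp add: char_fun_eq IA.m_assoc IA.Units_closed)
  then show ?thesis
    using zeta_fun_Units rank_power_closed by (simp add: moebius_fun_def)
qed

lemma char_fun_self: "s \<in> carrier P \<Longrightarrow> char_fun P s s = 1"
  using fun_cong[OF fun_cong[OF zeta_char_fun], of s s] zeta_fun_mult[of s s "char_fun P"]
  by (simp add: is_interval_def rank_power_def)

text \<open>The Moebius values over the interval sum to 0, so 1 may be subtracted from every power
  of \<open>x\<close>; each difference is then a multiple of \<open>x - 1\<close>.\<close>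

lemma dvd_char_fun:
  assumes "is_interval P s t" "s \<noteq> t"
  shows "polyX - 1 dvd char_fun P s t"
proof -
  have "(moebius_fun P \<otimes>\<^bsub>IA\<^esub> zeta_fun P) s t = 0"
    using zeta_fun_Units assms by (simp add: moebius_fun_def IA_one)
  moreover have "(moebius_fun P \<otimes>\<^bsub>IA\<^esub> zeta_fun P) s t = (\<Sum>w \<in> \<lbrace>s..t\<rbrace>. moebius_fun P s w)"
    unfolding IA_mult
    by (rule sum.cong) (use assms in \<open>auto simp: zeta_fun_def is_interval_def at_least_at_most_def\<close>)
  ultimately have "char_fun P s t =
      (\<Sum>w \<in> \<lbrace>s..t\<rbrace>. moebius_fun P s w * (polyX ^ rank_diff P w t - 1))"
    using assms by (simp add: char_fun_def right_diff_distrib sum_subtractf)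
  also have "polyX - 1 dvd \<dots>"
    by (intro dvd_sum dvd_mult polyX_minus_1_dvd_power)
  finally show ?thesis .
qed

section \<open>The reduced characteristic function\<close>

text \<open>A division-free description. On the diagonal, \<open>(x - 1) * (-1) = 1 - x\<close>,
  which accounts for the correction by \<open>x\<close>.\<close>

lemma reduced_char_fun_mult:
  assumes "is_interval P s t"
  shows "(polyX - 1) * reduced_char_fun P s t = char_fun P s t - (if s = t then polyX else 0)"
proof (cases "s = t")
  case True
  then show ?thesis
    using assms is_intervalD[OF assms] by (simp add: reduced_char_fun_def char_fun_self)
next
  case False
  then show ?thesis
    using assms dvd_mult_div_cancel[OF dvd_char_fun[OF assms False]]
    by (simp add: reduced_char_fun_def)
qed

lemma reduced_char_fun_Units: "reduced_char_fun P \<in> Units IA"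
  by (rule IA_Units) (auto simp: IA_carrier reduced_char_fun_def is_interval_def)

text \<open>These are the entries of \<open>E - 1\<close>. Off the diagonal both sides are compared
  after multiplication by \<open>x - 1\<close>: only \<open>w = t\<close> carries the correction, so
  the sum is \<open>x^r - x\<close> with \<open>r\<close> the rank difference.\<close>

lemma zeta_reduced_char_fun:
  assumes "is_interval P s t"
  shows "(zeta_fun P \<otimes>\<^bsub>IA\<^esub> reduced_char_fun P) s t = (if s = t then - 1 else chow_step P s t)"
proof (cases "s = t")
  case True
  then show ?thesis
    using assms is_intervalD[OF assms] by (simp add: zeta_fun_mult reduced_char_fun_def)
next
  case False
  have st: "s \<in> carrier P" "t \<in> carrier P" "s \<sqsubseteq> t" using is_intervalD[OF assms] by auto
  then have t: "t \<in> \<lbrace>s..t\<rbrace>" by (auto simp: at_least_at_most_def)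
  have "(polyX - 1) * (zeta_fun P \<otimes>\<^bsub>IA\<^esub> reduced_char_fun P) s t =
      (\<Sum>w \<in> \<lbrace>s..t\<rbrace>. char_fun P w t - (if w = t then polyX else 0))"
    unfolding zeta_fun_mult[OF assms] sum_distrib_left
    by (rule sum.cong[OF HOL.refl], rule reduced_char_fun_mult)
      (use st in \<open>auto simp: is_interval_def at_least_at_most_def\<close>)
  also have "\<dots> = (zeta_fun P \<otimes>\<^bsub>IA\<^esub> char_fun P) s t - polyX"
    using t by (simp add: zeta_fun_mult[OF assms] sum_subtractf)
  also have "\<dots> = polyX ^ (rank P t - rank P s) - polyX"
    using assms by (simp add: zeta_char_fun rank_power_def rank_diff_def)
  also have "\<dots> = polyX * (polyX ^ (rank P t - rank P s - 1) - 1)"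
  proof -
    \<comment> \<open>Strict growth of the rank keeps the subtraction of 1 from truncating.\<close>
    have "rank P t - rank P s = Suc (rank P t - rank P s - 1)"
      using rank_less[of s t] st False by (simp add: lless_eq)
    then have "polyX ^ (rank P t - rank P s) = polyX * polyX ^ (rank P t - rank P s - 1)"
      by (metis power_Suc)
    then show ?thesis by (simp only: right_diff_distrib mult_1_right)
  qed
  also have "\<dots> = (polyX - 1) * chow_step P s t"
    by (rule chow_step_mult[symmetric])
  finally have "(polyX - 1) * (zeta_fun P \<otimes>\<^bsub>IA\<^esub> reduced_char_fun P) s t =
    (polyX - 1) * chow_step P s t" .
  moreover have "polyX - 1 \<noteq> 0" by (simp add: one_pCons)
  ultimately show ?thesis
    using False by (simp only: mult_cancel_left if_False simp_thms)
qed

section \<open>The recursion of the Chow function and its solution\<close>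

lemma zeta_reduced_char_chow:
  "(zeta_fun P \<otimes>\<^bsub>IA\<^esub> reduced_char_fun P) \<otimes>\<^bsub>IA\<^esub> chow_fun P = \<ominus>\<^bsub>IA\<^esub> zeta_fun P"
  using zeta_fun_Units reduced_char_fun_Units
  by (simp add: chow_fun_def IA.m_assoc IA.r_minus IA.Units_closed)

text \<open>The entry at \<open>(s, t)\<close> of \<open>(E - 1) H = -\<zeta>\<close>, whose term at
  \<open>w = s\<close> is \<open>- chow_fun P s t\<close>.\<close>

lemma chow_fun_rec:
  assumes "is_interval P s t"
  shows "chow_fun P s t = 1 + (\<Sum>w \<in> \<lbrace>s..t\<rbrace> - {s}. chow_step P s w * chow_fun P w t)"
proof -
  have st: "s \<in> carrier P" "t \<in> carrier P" "s \<sqsubseteq> t" using is_intervalD[OF assms] by auto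
  then have s: "s \<in> \<lbrace>s..t\<rbrace>" by (auto simp: at_least_at_most_def)
  have "- 1 = (\<ominus>\<^bsub>IA\<^esub> zeta_fun P) s t"
    using assms zeta_fun_Units by (simp add: IA_minus IA.Units_closed zeta_fun_def)
  also have "\<dots> = ((zeta_fun P \<otimes>\<^bsub>IA\<^esub> reduced_char_fun P) \<otimes>\<^bsub>IA\<^esub> chow_fun P) s t"
    by (simp only: zeta_reduced_char_chow)
  also have "\<dots> = (\<Sum>w \<in> \<lbrace>s..t\<rbrace>. (if s = w then - 1 else chow_step P s w) * chow_fun P w t)"
    unfolding IA_mult[of "zeta_fun P \<otimes>\<^bsub>IA\<^esub> reduced_char_fun P"]
    by (rule sum.cong[OF HOL.refl], subst zeta_reduced_char_fun)
      (use st in \<open>auto simp: is_interval_def at_least_at_most_def\<close>)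
  also have "\<dots> = - chow_fun P s t + (\<Sum>w \<in> \<lbrace>s..t\<rbrace> - {s}. chow_step P s w * chow_fun P w t)"
  proof (subst sum.remove[OF finite_at_least_at_most s], rule arg_cong2[where f = plus])
    show "(\<Sum>w \<in> \<lbrace>s..t\<rbrace> - {s}. (if s = w then - 1 else chow_step P s w) * chow_fun P w t) =
        (\<Sum>w \<in> \<lbrace>s..t\<rbrace> - {s}. chow_step P s w * chow_fun P w t)"
      by (rule sum.cong) auto
  qed simp
  finally show ?thesis by (simp add: algebra_simps)
qed

lemma chow_fun_top_eq_chain_sum:
  assumes "s \<in> carrier P"
  shows "chow_fun P s \<top> =
    (\<Sum>ps \<in> chains_from P s. \<Prod>i = 1..length ps - 1. chow_step P (ps ! (i - 1)) (ps ! i))"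
  using assms
proof (induction rule: above_induct)
  case (above s)
  \<comment> \<open>With upper end \<open>\<top>\<close> the index set is that of
    \<open>chain_sum_rec\<close>, so the two recursions coincide.\<close>
  have "\<lbrace>s..\<top>\<rbrace> - {s} = {w \<in> carrier P. s \<sqsubset> w}"
    by (auto simp: at_least_at_most_def lless_eq)
  with chow_fun_rec[of s \<top>] above.hyps
  have "chow_fun P s \<top> = 1 + (\<Sum>w \<in> {w \<in> carrier P. s \<sqsubset> w}. chow_step P s w * chow_fun P w \<top>)"
    by (simp add: is_interval_def)
  also have "\<dots> = 1 + (\<Sum>w \<in> {w \<in> carrier P. s \<sqsubset> w}. chow_step P s w *
      (\<Sum>ps \<in> chains_from P w. \<Prod>i = 1..length ps - 1. chow_step P (ps ! (i - 1)) (ps ! i)))"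
    using above.IH by (intro arg_cong2[where f = plus] sum.cong) auto
  also have "\<dots> = (\<Sum>ps \<in> chains_from P s. \<Prod>i = 1..length ps - 1. chow_step P (ps ! (i - 1)) (ps ! i))"
    by (rule chain_sum_rec[OF above.hyps, symmetric])
  finally show ?case .
qed

lemma chains_from_bottom_eq: "chains_from_bottom P = chains_from P \<bottom>"
proof -
  have "last ps \<sqsubseteq> \<top>" if "ps \<noteq> []" "set ps \<subseteq> carrier P" for ps
    using that last_in_set[of ps] by blast
  then show ?thesis unfolding chains_from_bottom_def chains_from_def by blast
qed

end

theorem theorem4p1:
  fixes P :: "('a, 'b) gorder_scheme"
  assumes "finite_graded_bounded_poset P"
  shows "chow_polynomial P =
    (\<Sum>ps \<in> chains_from_bottom P. \<Prod>i = 1..length ps - 1.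
       (polyX * (polyX ^ (rank P (ps ! i) - rank P (ps ! (i - 1)) - 1) - 1)) div (polyX - 1))"
proof -
  interpret finite_graded_bounded_poset P by (rule assms)
  show ?thesis
    unfolding chow_polynomial_def chains_from_bottom_eq chow_fun_top_eq_chain_sum[OF bottom_closed]
    by (simp only: chow_step_def)
qed

end
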